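(* Let $\lambda$ be a nonzero real number and let $r\ge0$ be an integer. For every integer $m\ge0$, as power series in $x$, $$\frac{1}{1-x}F_{m,\lambda}^{(r)}\left(\frac{x}{1-x}\right)=\sum_{n=0}^{\infty}(n+r)_{m,\lambda}x^{n}.$$ In particular, also $$F_{m,\lambda}^{(r)}(1)=\sum_{n=0}^{\infty}(n+r)_{m,\lambda}\left(\frac{1}{2}\right)^{n+1}.$$
   Context: Degenerate falling factorials: $(y)_{0,\lambda}=1$ and $(y)_{n,\lambda}=y(y-\lambda)\cdots(y-(n-1)\lambda)$ for $n\ge1$. Degenerate exponentials: $e_\lambda^{y}(t)=\sum_{n=0}^{\infty}\frac{(y)_{n,\lambda}}{n!}t^n$ and $e_\lambda(t)=e_\lambda^{1}(t)$. The degenerate $r$-Fubini polynomials $F_{n,\lambda}^{(r)}(x)$ are defined by the generating function (formal power series in $t$) $$\sum_{n=0}^{\infty}F_{n,\lambda}^{(r)}(x)\frac{t^{n}}{n!}=e_{\lambda}^{r}(t)\,\frac{1}{1-x(e_{\lambda}(t)-1)}.$$ $F_{m,\lambda}^{(r)}(1)$, also written $F_{m,\lambda}^{(r)}$, are called the $r$-Fubini numbers. *)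

theory Defs
  imports "HOL-Computational_Algebra.Computational_Algebra" Complex_Main
begin

definition deg_ffact :: "real \<Rightarrow> real \<Rightarrow> nat \<Rightarrow> real" where
  "deg_ffact lam y n = (\<Prod>i<n. y - real i * lam)"

definition deg_exp :: "real \<Rightarrow> real \<Rightarrow> real fps" where
  "deg_exp lam y = Abs_fps (\<lambda>n. deg_ffact lam y n / fact n)"

(* Power series in t over the reals, viewed as power series in t over the polynomial ring in x. *)
definition lift_fps :: "real fps \<Rightarrow> real poly fps" where
  "lift_fps f = Abs_fps (\<lambda>n. [:fps_nth f n:])"

(* The generating function lives in R[x][[t]]. The indeterminate x is [:0, 1:], and the
   denominator has constant term 1, so it is inverted by the ring version of the
   power series inverse, whose second argument is the inverse of that constant term;
   see fubini_gf_mult. *)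
definition fubini_gf :: "real \<Rightarrow> nat \<Rightarrow> real poly fps" where
  "fubini_gf lam r =
     lift_fps (deg_exp lam (real r)) *
     fps_right_inverse (1 - fps_const [:0, 1:] * (lift_fps (deg_exp lam 1) - 1)) 1"

definition deg_fubini :: "real \<Rightarrow> nat \<Rightarrow> nat \<Rightarrow> real poly" where
  "deg_fubini lam r m = smult (fact m) (fps_nth (fubini_gf lam r) m)"

lemma fubini_gf_mult:
  "fubini_gf lam r * (1 - fps_const [:0, 1:] * (lift_fps (deg_exp lam 1) - 1))
     = lift_fps (deg_exp lam (real r))"
proof -
  define D where "D = 1 - fps_const [:0, 1:] * (lift_fps (deg_exp lam 1) - 1)"
  have "fps_nth D 0 = 1"
    by (simp add: D_def lift_fps_def deg_exp_def deg_ffact_def one_pCons)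
  then have D: "D * fps_right_inverse D 1 = 1"
    by (intro fps_right_inverse) simp
  have "lift_fps (deg_exp lam (real r)) * fps_right_inverse D 1 * D
      = lift_fps (deg_exp lam (real r)) * (D * fps_right_inverse D 1)"
    by (simp only: mult.assoc mult.commute[of D])
  also have "\<dots> = lift_fps (deg_exp lam (real r))"
    by (simp only: D mult_1_right)
  finally show ?thesis
    by (simp only: fubini_gf_def D_def)
qed

end

theory Submission
  imports Defs
begin

text \<open>
  Both claims say that the coefficients of the Fubini polynomial are the coefficients in the Newton
  expansion of \<open>n \<mapsto> (n + r)\<^bsub>m,\<lambda>\<^esub>\<close>.

  Write \<open>E\<close> for the degenerate exponential \<open>e\<^sub>\<lambda>(t)\<close>. Expanding the generating function as a geometric
  series shows that the coefficient of \<open>x\<^sup>k\<close> in it is \<open>E\<^sup>r (E - 1)\<^sup>k\<close>, a power series in \<open>t\<close> that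
  starts at \<open>t\<^sup>k\<close> or later. Since \<open>E\<^sup>y E\<^sup>z = E\<^bsup>y+z\<^esup>\<close>, the binomial theorem for \<open>(1 + (E - 1))\<^sup>n E\<^sup>r\<close>
  gives, on comparing coefficients of \<open>t\<^sup>m / m!\<close>,
  \<open>(n + r)\<^bsub>m,\<lambda>\<^esub> = (\<Sum>k\<le>m. (n choose k) c\<^sub>k)\<close>, where \<open>c\<^sub>k\<close> is the coefficient of \<open>x\<^sup>k\<close> in the Fubini
  polynomial (lemma \<open>deg_ffact_newton\<close>).

  It remains to sum over \<open>n\<close> one binomial column at a time. The column \<open>k\<close> has generating function
  \<open>x\<^sup>k / (1 - x)\<^bsup>k+1\<^esup>\<close>, which is \<open>1 / (1 - x)\<close> times the \<open>k\<close>th power of the substituted series, and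
  its value at \<open>x = 1/2\<close> is \<open>2\<close>, whatever \<open>k\<close> is; hence the weights \<open>(1/2)\<^bsup>n+1\<^esup>\<close> turn the
  expansion into the sum of all the \<open>c\<^sub>k\<close>, which is the value of the polynomial at \<open>1\<close>.
\<close>

section \<open>Degenerate exponentials\<close>

lemma deg_ffact_eq_gchoose:
  assumes "lam \<noteq> 0"
  shows "deg_ffact lam y n / fact n = lam ^ n * ((y / lam) gchoose n)"
proof -
  have "lam ^ n * (\<Prod>i<n. y / lam - real i) = (\<Prod>i<n. lam * (y / lam - real i))"
    by (simp add: prod.distrib)
  also have "\<dots> = deg_ffact lam y n"
    unfolding deg_ffact_def using assms by (intro prod.cong) (auto simp: field_simps)
  finally show ?thesis
    by (simp add: gbinomial_prod_rev lessThan_atLeast0)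
qed

text \<open>After rescaling by \<open>\<lambda>\<close>, degenerate falling factorials are generalised binomial coefficients,
  so the law of exponents is Vandermonde's convolution.\<close>

lemma deg_exp_add:
  assumes "lam \<noteq> 0"
  shows "deg_exp lam (y + z) = deg_exp lam y * deg_exp lam z"
proof (rule fps_ext)
  fix n
  have "(\<Sum>i=0..n. (lam ^ i * ((y / lam) gchoose i)) * (lam ^ (n - i) * ((z / lam) gchoose (n - i))))
      = (\<Sum>i=0..n. lam ^ n * (((y / lam) gchoose i) * ((z / lam) gchoose (n - i))))"
  proof (rule sum.cong)
    fix i assume "i \<in> {0..n}"
    then have "lam ^ n = lam ^ i * lam ^ (n - i)"
      by (simp flip: power_add)
    then show "(lam ^ i * ((y / lam) gchoose i)) * (lam ^ (n - i) * ((z / lam) gchoose (n - i)))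
        = lam ^ n * (((y / lam) gchoose i) * ((z / lam) gchoose (n - i)))"
      by simp
  qed simp
  also have "\<dots> = lam ^ n * (((y + z) / lam) gchoose n)"
    by (simp add: gbinomial_Vandermonde add_divide_distrib flip: sum_distrib_left)
  finally show "deg_exp lam (y + z) $ n = (deg_exp lam y * deg_exp lam z) $ n"
    by (simp add: deg_exp_def fps_mult_nth deg_ffact_eq_gchoose[OF assms])
qed

lemma deg_exp_0: "deg_exp lam 0 = 1"
proof (rule fps_ext)
  fix n
  show "deg_exp lam 0 $ n = 1 $ n"
    by (cases n) (simp_all add: deg_exp_def deg_ffact_def prod.lessThan_Suc_shift del: prod.lessThan_Suc)
qed

lemma deg_exp_of_nat:
  assumes "lam \<noteq> 0"
  shows "deg_exp lam (real n) = deg_exp lam 1 ^ n"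
  by (induction n) (simp_all add: deg_exp_0 deg_exp_add[OF assms])

section \<open>Coefficients of the Fubini polynomials\<close>

text \<open>A series in \<open>t\<close> over the polynomials in \<open>x\<close> is a double array of coefficients; reading it by
  powers of \<open>x\<close> makes every column an ordinary real power series in \<open>t\<close>.\<close>

definition x_coeff :: "nat \<Rightarrow> real poly fps \<Rightarrow> real fps" where
  "x_coeff k G = Abs_fps (\<lambda>m. coeff (G $ m) k)"

lemma x_coeff_diff: "x_coeff k (G - H) = x_coeff k G - x_coeff k H"
  by (simp add: x_coeff_def fps_eq_iff)

lemma x_coeff_lift: "x_coeff k (lift_fps f) = (if k = 0 then f else 0)"
  by (auto simp: x_coeff_def lift_fps_def fps_eq_iff split: nat.split)
     (auto simp: coeff_pCons split: nat.split)

lemma x_coeff_mult_lift: "x_coeff k (G * lift_fps f) = x_coeff k G * f"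
  by (simp add: x_coeff_def lift_fps_def fps_eq_iff fps_mult_nth coeff_sum mult.commute[of "coeff _ _"])

lemma x_coeff_mult_x:
  "x_coeff k (fps_const [:0, 1:] * G) = (case k of 0 \<Rightarrow> 0 | Suc j \<Rightarrow> x_coeff j G)"
  by (simp add: x_coeff_def fps_eq_iff coeff_pCons split: nat.split)

text \<open>Comparing coefficients of \<open>x\<^sup>k\<close> in \<open>G = E\<^sup>r + x G (E - 1)\<close> yields a recursion on \<open>k\<close> with
  factor \<open>E - 1\<close>.\<close>

lemma x_coeff_fubini_gf:
  "x_coeff k (fubini_gf lam r) = deg_exp lam (real r) * (deg_exp lam 1 - 1) ^ k"
proof -
  let ?G = "fubini_gf lam r" and ?E = "deg_exp lam 1"
  have one: "lift_fps ?E - 1 = lift_fps (?E - 1)"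
    by (simp add: lift_fps_def fps_eq_iff one_pCons)
  have "?G - fps_const [:0, 1:] * (?G * lift_fps (?E - 1)) = lift_fps (deg_exp lam (real r))"
    using fubini_gf_mult[of lam r] unfolding one by (simp only: algebra_simps mult_1_left mult_1_right)
  then have rec: "x_coeff k ?G
      = x_coeff k (lift_fps (deg_exp lam (real r)))
        + x_coeff k (fps_const [:0, 1:] * (?G * lift_fps (?E - 1)))" for k
    by (metis x_coeff_diff diff_add_cancel)
  show ?thesis
  proof (induction k)
    case 0
    then show ?case by (simp add: rec[of 0] x_coeff_lift x_coeff_mult_x)
  next
    case (Suc k)
    have "x_coeff (Suc k) ?G = x_coeff k ?G * (?E - 1)"
      by (simp add: rec[of "Suc k"] x_coeff_lift x_coeff_mult_x x_coeff_mult_lift)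
    then show ?case
      by (simp add: Suc mult_ac)
  qed
qed

lemma coeff_deg_fubini:
  "coeff (deg_fubini lam r m) k
     = fact m * (deg_exp lam (real r) * (deg_exp lam 1 - 1) ^ k) $ m"
  by (simp add: deg_fubini_def x_coeff_def flip: x_coeff_fubini_gf)

text \<open>The series \<open>E - 1\<close> has no constant term, so its \<open>k\<close>th power cannot contribute to \<open>t\<^sup>m\<close> when
  \<open>m < k\<close>.\<close>

lemma coeff_deg_fubini_eq_0:
  assumes "m < k"
  shows "coeff (deg_fubini lam r m) k = 0"
proof -
  have "(deg_exp lam 1 - 1) $ 0 = 0"
    by (simp add: deg_exp_def deg_ffact_def)
  then have "((deg_exp lam 1 - 1) ^ k) $ j = 0" if "j \<le> m" for j
    using that assms by (intro startsby_zero_power_prefix[rule_format]) auto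
  then show ?thesis
    by (simp add: coeff_deg_fubini fps_mult_nth)
qed

lemma degree_deg_fubini_le: "degree (deg_fubini lam r m) \<le> m"
  by (rule degree_le) (simp add: coeff_deg_fubini_eq_0)

text \<open>This is the binomial theorem for \<open>E\<^sup>r E\<^sup>n = E\<^sup>r ((E - 1) + 1)\<^sup>n\<close>, read at \<open>t\<^sup>m\<close> and scaled by \<open>m!\<close>.\<close>

lemma deg_ffact_newton:
  assumes "lam \<noteq> 0"
  shows "deg_ffact lam (real (n + r)) m
     = (\<Sum>k\<le>m. coeff (deg_fubini lam r m) k * real (n choose k))"
proof -
  let ?E = "deg_exp lam 1" and ?c = "coeff (deg_fubini lam r m)"
  have "deg_exp lam (real (n + r)) = deg_exp lam (real r) * ((?E - 1) + 1) ^ n"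
    using deg_exp_add[OF assms, of "real r" "real n"]
    by (simp add: deg_exp_of_nat[OF assms] add.commute)
  also have "\<dots> = (\<Sum>k\<le>n. fps_const (real (n choose k)) * (deg_exp lam (real r) * (?E - 1) ^ k))"
    unfolding binomial_ring by (simp add: sum_distrib_left fps_of_nat algebra_simps)
  finally have "deg_ffact lam (real (n + r)) m
      = (\<Sum>k\<le>n. ?c k * real (n choose k))"
    by (simp add: coeff_deg_fubini fps_sum_nth deg_exp_def fps_eq_iff field_simps
        sum_distrib_left sum_divide_distrib)
  \<comment> \<open>Either sum may be the longer one: terms with \<open>k > n\<close> vanish by the binomial coefficient,
     terms with \<open>k > m\<close> by the degree of the Fubini polynomial.\<close>
  also have "\<dots> = (\<Sum>k\<le>max m n. ?c k * real (n choose k))"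
    by (rule sum.mono_neutral_left) auto
  also have "\<dots> = (\<Sum>k\<le>m. ?c k * real (n choose k))"
    by (rule sum.mono_neutral_right) (auto simp: coeff_deg_fubini_eq_0)
  finally show ?thesis .
qed

section \<open>Summing a column of Pascal's triangle\<close>

text \<open>Pascal's rule says that passing from column \<open>k\<close> to column \<open>k + 1\<close> multiplies the generating
  function by \<open>x / (1 - x)\<close>.\<close>

lemma fps_binomial_column:
  "Abs_fps (\<lambda>n. real (n choose k)) = 1 / (1 - fps_X) * (fps_X / (1 - fps_X)) ^ k"
proof (induction k)
  case 0
  show ?case
    by (simp add: fps_divide_unit flip: fps_inverse_gp')
next
  case (Suc k)
  let ?B = "\<lambda>k. Abs_fps (\<lambda>n. real (n choose k))"
  have "?B (Suc k) * (1 - fps_X) = ?B k * fps_X"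
  proof (rule fps_ext)
    fix n
    show "(?B (Suc k) * (1 - fps_X)) $ n = (?B k * fps_X) $ n"
      by (cases n) (simp_all add: right_diff_distrib)
  qed
  then have "?B (Suc k) * ((1 - fps_X) * inverse (1 - fps_X)) = ?B k * fps_X * inverse (1 - fps_X)"
    by (metis mult.assoc)
  then have "?B (Suc k) = ?B k * (fps_X / (1 - fps_X))"
    by (simp add: fps_divide_unit inverse_mult_eq_1' mult.assoc)
  then show ?case
    by (simp add: Suc mult_ac)
qed

text \<open>The same rule numerically. Halving the weights shows that the partial sums of column \<open>k + 1\<close>
  differ from those of column \<open>k\<close> only by a boundary term; its sign gives boundedness, hence
  convergence, and then convergence forces it to tend to zero.\<close>

lemma binomial_column_sums_half:
  "(\<lambda>n. real (n choose k) * (1 / 2) ^ (n + 1)) sums 1"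
proof (induction k)
  case 0
  then show ?case using power_half_series by simp
next
  case (Suc k)
  let ?b = "\<lambda>k n. real (n choose k) * (1 / 2) ^ (n + 1)"
  have partial: "(\<Sum>n<N. ?b (Suc k) n) = (\<Sum>n<N. ?b k n) - 2 * ?b (Suc k) N" for N
  proof (induction N)
    case (Suc N)
    have "2 * ?b (Suc k) (Suc N) = ?b k N + ?b (Suc k) N"
      by (simp add: field_simps)
    then show ?case
      unfolding sum.lessThan_Suc Suc by linarith
  qed simp
  have "summable (?b (Suc k))"
  proof (rule summableI_nonneg_bounded)
    fix N
    have "(\<Sum>n<N. ?b k n) \<le> 1"
      using sum_le_suminf[OF sums_summable[OF Suc], of "{..<N}"] sums_unique[OF Suc] by simp
    then show "(\<Sum>n<N. ?b (Suc k) n) \<le> 1"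
      unfolding partial by (smt (verit) zero_le_mult_iff of_nat_0_le_iff zero_le_power zero_le_divide_1_iff)
  qed simp
  then have "?b (Suc k) \<longlonglongrightarrow> 0"
    by (rule summable_LIMSEQ_zero)
  then have "(\<lambda>N. (\<Sum>n<N. ?b k n) - 2 * ?b (Suc k) N) \<longlonglongrightarrow> 1 - 2 * 0"
    using Suc unfolding sums_def by (intro tendsto_intros)
  then show ?case
    unfolding sums_def partial by simp
qed

section \<open>The generating function and its value at one half\<close>

theorem theorem3:
  fixes lam :: real and r m :: nat
  assumes "lam \<noteq> 0"
  shows "(1 / (1 - fps_X)) *
           (fps_of_poly (deg_fubini lam r m) oo (fps_X / (1 - fps_X)))
         = Abs_fps (\<lambda>n. deg_ffact lam (real (n + r)) m)
       \<and> (\<lambda>n. deg_ffact lam (real (n + r)) m * (1 / 2) ^ (n + 1))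
           sums poly (deg_fubini lam r m) 1"
proof
  let ?P = "deg_fubini lam r m"
  have P: "fps_of_poly ?P = (\<Sum>k\<le>m. fps_const (coeff ?P k) * fps_X ^ k)"
    by (rule fps_ext) (auto simp: fps_sum_nth fps_X_power_nth coeff_deg_fubini_eq_0 mult_delta_right sum.delta)
  have X0: "(fps_X / (1 - fps_X) :: real fps) $ 0 = 0"
    by (simp add: fps_divide_unit)
  have "fps_of_poly ?P oo (fps_X / (1 - fps_X))
      = (\<Sum>k\<le>m. fps_const (coeff ?P k) * (fps_X / (1 - fps_X)) ^ k)"
    unfolding P by (simp add: fps_compose_sum_distrib fps_compose_mult_distrib[OF X0]
        X0 flip: fps_compose_power[OF X0])
  then have "(1 / (1 - fps_X)) * (fps_of_poly ?P oo (fps_X / (1 - fps_X)))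
      = (\<Sum>k\<le>m. fps_const (coeff ?P k) * Abs_fps (\<lambda>n. real (n choose k)))"
    unfolding fps_binomial_column by (simp only: sum_distrib_left mult.left_commute)
  also have "\<dots> = Abs_fps (\<lambda>n. deg_ffact lam (real (n + r)) m)"
    by (rule fps_ext) (simp add: fps_sum_nth deg_ffact_newton[OF assms] del: of_nat_add)
  finally show "(1 / (1 - fps_X)) * (fps_of_poly ?P oo (fps_X / (1 - fps_X)))
      = Abs_fps (\<lambda>n. deg_ffact lam (real (n + r)) m)" .

  have "(\<lambda>n. \<Sum>k\<le>m. coeff ?P k * (real (n choose k) * (1 / 2) ^ (n + 1))) sums (\<Sum>k\<le>m. coeff ?P k * 1)"
    by (intro sums_sum sums_mult binomial_column_sums_half)
  also have "(\<Sum>k\<le>m. coeff ?P k * 1) = poly ?P 1"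
    using arg_cong[OF poly_as_sum_of_monoms'[OF degree_deg_fubini_le], of "\<lambda>p. poly p 1"]
    by (simp add: poly_sum poly_monom)
  finally show "(\<lambda>n. deg_ffact lam (real (n + r)) m * (1 / 2) ^ (n + 1)) sums poly ?P 1"
    unfolding deg_ffact_newton[OF assms] by (simp only: sum_distrib_right mult.assoc)
qed

end
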